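(* Let $\theta>0$. For $(a,b,q)$ with $0\le a\le b\le 1$ and $0\le q\le 1$, let the social welfare be $$W(a,b,q)=\int_0^1 \max\left\{\theta q-(i-a)^2,\ \theta(1-q)-(i-b)^2\right\}\,di .$$ A social optimum is a triple $(a,b,q)$ that maximizes $W$ over the set $\{(a,b,q): 0\le a\le b\le 1,\ 0\le q\le 1\}$. Then the social optima are exactly the following: - if $\theta\in\left(0,\frac14\right)$: the two configurations $\left(\frac14+\theta,\frac34+\theta,1\right)$ and $\left(\frac14-\theta,\frac34-\theta,0\right)$; - if $\theta\in\left[\frac14,\infty\right)$: the configurations $\left(\frac12,b,1\right)$ with $b\in\left[\frac12,1\right]$ and the configurations $\left(a,\frac12,0\right)$ with $a\in\left[0,\frac12\right]$.
   Context: Individuals are uniformly distributed over $I=[0,1]$. A configuration of facilities is a triple $(a,b,q)$ with $0\le a\le b\le 1$ and $0\le q\le 1$: two facilities are located at $a$ and $b$, with qualities $q_a=q$ and $q_b=1-q$ respectively. An individual located at $i\in I$ who consumes the public service at $x\in\{a,b\}$ obtains utility $u(i,x)=\theta q_x-(i-x)^2$, where $\theta>0$ is the quality valuation. Each individual uses a facility $x(i)$ that maximizes his utility, and social welfare is $\int_0^1 \left(\theta q_{x(i)}-(i-x(i))^2\right)di$, i.e. the integral over $i\in[0,1]$ of the larger of the two utilities. This is the function $W$ in the claim. *)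

theory Defs
  imports "HOL-Analysis.Analysis"
begin

definition configurations :: "(real \<times> real \<times> real) set" where
  "configurations = {(a, b, q). 0 \<le> a \<and> a \<le> b \<and> b \<le> 1 \<and> 0 \<le> q \<and> q \<le> 1}"

definition utility :: "real \<Rightarrow> real \<Rightarrow> real \<Rightarrow> real \<Rightarrow> real" where
  "utility \<theta> quality i x = \<theta> * quality - (i - x)\<^sup>2"

text \<open>The integrand is continuous in \<open>i\<close>, so the Henstock-Kurzweil integral used here
  agrees with the Riemann and Lebesgue integrals.\<close>

definition welfare :: "real \<Rightarrow> real \<times> real \<times> real \<Rightarrow> real" where
  "welfare \<theta> = (\<lambda>(a, b, q).
     integral {0..1} (\<lambda>i. max (utility \<theta> q i a) (utility \<theta> (1 - q) i b)))"

definition social_optima :: "real \<Rightarrow> (real \<times> real \<times> real) set" where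
  "social_optima \<theta> =
     {c \<in> configurations. \<forall>c' \<in> configurations. welfare \<theta> c' \<le> welfare \<theta> c}"

end

(* Splitting [0,1] at t and serving [0,t] from a and [t,1] from b yields the welfare
     theta (q t + (1 - q) (1 - t)) - 1/12 + t (1 - t) / 4
       - t (a - t/2)^2 - (1 - t) (b - (1 + t)/2)^2.
   As the difference of the two utilities is affine and nonincreasing in i, welfare is the
   maximum of this expression over t.  The joint maximum over (t, a, b, q) is found
   separately for t >= 1/2 (forcing q = 1) and t <= 1/2 (forcing q = 0): by completing the
   square in t if theta < 1/4; otherwise the quadratic in t is maximal at the boundary
   t = 1 or t = 0, where the facility serving nobody can be anywhere. *)
theory Submission
  imports Defs
begin

section \<open>Welfare of a fixed split\<close>

text \<open>Distance costs are decomposed around the midpoints \<open>t/2\<close> and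
  \<open>(1 + t)/2\<close> of the two service areas: the variance terms \<open>t^3/12\<close> and
  \<open>(1 - t)^3/12\<close> add up to \<open>1/12 - t * (1 - t) / 4\<close>, and the squares
  measure how far \<open>a\<close> and \<open>b\<close> are from the midpoints.\<close>

definition split_welfare :: "real \<Rightarrow> real \<times> real \<times> real \<Rightarrow> real \<Rightarrow> real" where
  "split_welfare \<theta> = (\<lambda>(a, b, q) t.
     \<theta> * (q * t + (1 - q) * (1 - t)) - 1/12 + t * (1 - t) / 4
     - t * (a - t/2)\<^sup>2 - (1 - t) * (b - (1 + t)/2)\<^sup>2)"

lemma has_integral_utility:
  assumes "u \<le> v"
  shows "((\<lambda>i. utility \<theta> q i x) has_integral
           \<theta> * q * (v - u) - ((v - x)^3 - (u - x)^3) / 3) {u..v}"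
proof -
  have "((\<lambda>i. \<theta> * q - (i - x)\<^sup>2) has_integral
          (\<theta> * q * v - (v - x)^3 / 3) - (\<theta> * q * u - (u - x)^3 / 3)) {u..v}"
    using assms
    by (intro fundamental_theorem_of_calculus)
       (auto intro!: derivative_eq_intros
             simp flip: has_real_derivative_iff_has_vector_derivative)
  then show ?thesis
    by (simp add: utility_def algebra_simps diff_divide_distrib)
qed

lemma has_integral_split_welfare:
  assumes "0 \<le> t" "t \<le> 1"
  shows "((\<lambda>i. if i \<le> t then utility \<theta> q i a else utility \<theta> (1 - q) i b)
           has_integral split_welfare \<theta> (a, b, q) t) {0..1}"
    (is "(?f has_integral _) _")
proof -
  have "(?f has_integral \<theta> * q * (t - 0) - ((t - a)^3 - (0 - a)^3) / 3) {0..t}"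
    using has_integral_utility[OF assms(1)] by (rule has_integral_eq[rotated]) auto
  \<comment> \<open>The integrand takes the \<open>a\<close> branch at \<open>t\<close> itself, so
    on this half it differs from the utility at \<open>b\<close> in at most one point.\<close>
  moreover have
    "(?f has_integral \<theta> * (1 - q) * (1 - t) - ((1 - b)^3 - (t - b)^3) / 3) {t..1}"
    using has_integral_utility[OF assms(2)]
    by (rule has_integral_spike_finite[of "{t}", rotated 2]) auto
  ultimately have "(?f has_integral
      (\<theta> * q * (t - 0) - ((t - a)^3 - (0 - a)^3) / 3) +
      (\<theta> * (1 - q) * (1 - t) - ((1 - b)^3 - (t - b)^3) / 3)) {0..1}"
    by (rule has_integral_combine[OF assms])
  moreover have "(\<theta> * q * (t - 0) - ((t - a)^3 - (0 - a)^3) / 3) +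
      (\<theta> * (1 - q) * (1 - t) - ((1 - b)^3 - (t - b)^3) / 3) = split_welfare \<theta> (a, b, q) t"
    by (simp add: split_welfare_def field_simps power2_eq_square power3_eq_cube)
  ultimately show ?thesis
    by simp
qed

section \<open>Welfare as the maximum over splits\<close>

text \<open>An assigned facility gives pointwise at most the larger of the two utilities.\<close>

lemma split_welfare_le_welfare:
  assumes "0 \<le> t" "t \<le> 1"
  shows "split_welfare \<theta> c t \<le> welfare \<theta> c"
proof (cases c)
  case (fields a b q)
  have "(\<lambda>i. max (utility \<theta> q i a) (utility \<theta> (1 - q) i b)) integrable_on {0..1}"
    unfolding utility_def by (intro integrable_continuous_real continuous_intros)
  then have "((\<lambda>i. max (utility \<theta> q i a) (utility \<theta> (1 - q) i b)) has_integral
      welfare \<theta> (a, b, q)) {0..1}"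
    by (simp add: welfare_def integrable_integral)
  with has_integral_split_welfare[OF assms] show ?thesis
    unfolding fields by (rule has_integral_le) auto
qed

text \<open>The threshold is the root \<open>c / d\<close> if that lies strictly between 0 and 1,
  and otherwise an endpoint of the unit interval, which also covers \<open>d = 0\<close>. Nothing is
  claimed at \<open>t\<close> itself, so at an endpoint one of the two conditions is
  vacuous.\<close>

lemma affine_sign_change:
  fixes c d :: real
  assumes "0 \<le> d"
  obtains t where "0 \<le> t" "t \<le> 1"
    "\<And>i. 0 \<le> i \<Longrightarrow> i < t \<Longrightarrow> 0 \<le> c - d * i" "\<And>i. t < i \<Longrightarrow> i \<le> 1 \<Longrightarrow> c - d * i \<le> 0"
proof -
  consider "c \<le> 0" | "d \<le> c" | "0 < c" "c < d"
    by linarith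
  then show thesis
  proof cases
    case 1
    show thesis
    proof (rule that[of 0])
      fix i :: real
      assume "0 < i"
      then have "0 \<le> d * i" using assms by simp
      with 1 show "c - d * i \<le> 0" by linarith
    qed auto
  next
    case 2
    show thesis
    proof (rule that[of 1])
      fix i :: real
      assume "i < 1"
      then have "d * i \<le> d" using assms by (simp add: mult_left_le)
      with 2 show "0 \<le> c - d * i" by linarith
    qed auto
  next
    case 3
    then show thesis
      by (intro that[of "c / d"]) (auto simp: field_simps)
  qed
qed

text \<open>Since \<open>a \<le> b\<close>, the gain from using \<open>a\<close> rather than
  \<open>b\<close> has slope \<open>- 2 * (b - a) \<le> 0\<close> in \<open>i\<close>. Splitting at
  its sign change gives everyone a best facility, except possibly the individual at
  \<open>t\<close>, who does not affect the integral.\<close>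

lemma welfare_eq_split_welfare:
  assumes "c \<in> configurations"
  obtains t where "0 \<le> t" "t \<le> 1" "welfare \<theta> c = split_welfare \<theta> c t"
proof (cases c)
  case (fields a b q)
  have "0 \<le> 2 * (b - a)"
    using assms by (simp add: fields configurations_def)
  then obtain t where t: "0 \<le> t" "t \<le> 1"
    and left: "\<And>i. 0 \<le> i \<Longrightarrow> i < t \<Longrightarrow> 0 \<le> (\<theta> * (2 * q - 1) + b\<^sup>2 - a\<^sup>2) - 2 * (b - a) * i"
    and right: "\<And>i. t < i \<Longrightarrow> i \<le> 1 \<Longrightarrow> (\<theta> * (2 * q - 1) + b\<^sup>2 - a\<^sup>2) - 2 * (b - a) * i \<le> 0"
    by (rule affine_sign_change) blast
  have diff: "utility \<theta> q i a - utility \<theta> (1 - q) i b =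
      (\<theta> * (2 * q - 1) + b\<^sup>2 - a\<^sup>2) - 2 * (b - a) * i" for i
    by (simp add: utility_def algebra_simps power2_eq_square)
  have "max (utility \<theta> q i a) (utility \<theta> (1 - q) i b) =
      (if i \<le> t then utility \<theta> q i a else utility \<theta> (1 - q) i b)" if "i \<in> {0..1} - {t}" for i
    using left[of i] right[of i] that unfolding diff[symmetric] by (auto simp: max_def)
  then have "((\<lambda>i. max (utility \<theta> q i a) (utility \<theta> (1 - q) i b)) has_integral
      split_welfare \<theta> (a, b, q) t) {0..1}"
    by (intro has_integral_spike_finite[OF _ _ has_integral_split_welfare[OF t], of "{t}"]) auto
  then have "welfare \<theta> c = split_welfare \<theta> c t"
    by (simp add: fields welfare_def integral_unique)
  with t show thesis
    by (rule that)
qed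

section \<open>Social optima\<close>

text \<open>This replaces maximization of an integral by maximization of a polynomial in
  \<open>t\<close> and \<open>c\<close>. Welfare is itself the value of some split, so the bound
  \<open>M\<close> and its equality case carry over; one split of value \<open>M\<close> suffices to
  show that a member of \<open>S\<close> attains the bound.\<close>

lemma social_optima_eqI:
  assumes "S \<subseteq> configurations" "S \<noteq> {}"
    and "\<And>c. c \<in> S \<Longrightarrow> \<exists>t\<in>{0..1}. split_welfare \<theta> c t = M"
    and "\<And>c t. c \<in> configurations \<Longrightarrow> t \<in> {0..1} \<Longrightarrow>
           split_welfare \<theta> c t \<le> M \<and> (split_welfare \<theta> c t = M \<longrightarrow> c \<in> S)"
  shows "social_optima \<theta> = S"
proof -
  have upper: "welfare \<theta> c \<le> M \<and> (welfare \<theta> c = M \<longrightarrow> c \<in> S)"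
    if c: "c \<in> configurations" for c
  proof -
    obtain t where "0 \<le> t" "t \<le> 1" "welfare \<theta> c = split_welfare \<theta> c t"
      by (rule welfare_eq_split_welfare[OF c])
    with assms(4)[OF c, of t] show ?thesis
      by simp
  qed
  have attained: "welfare \<theta> c = M" if c: "c \<in> S" for c
  proof (rule antisym)
    show "welfare \<theta> c \<le> M"
      using upper c assms(1) by blast
    obtain t where "t \<in> {0..1}" "split_welfare \<theta> c t = M"
      using assms(3)[OF c] by blast
    then show "M \<le> welfare \<theta> c"
      using split_welfare_le_welfare[of t \<theta> c] by simp
  qed
  show ?thesis
  proof (intro equalityI subsetI)
    fix c assume c: "c \<in> social_optima \<theta>"
    obtain c0 where "c0 \<in> S"
      using assms(2) by blast
    then have "M \<le> welfare \<theta> c"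
      using c attained[of c0] assms(1) by (auto simp: social_optima_def)
    with c upper[of c] show "c \<in> S"
      by (simp add: social_optima_def)
  next
    fix c assume "c \<in> S"
    then show "c \<in> social_optima \<theta>"
      using assms(1) attained[of c] upper by (auto simp: social_optima_def)
  qed
qed

lemma social_optima_small:
  fixes \<theta> :: real
  assumes "0 < \<theta>" "\<theta> < 1/4"
  shows "social_optima \<theta> = {(1/4 + \<theta>, 3/4 + \<theta>, 1), (1/4 - \<theta>, 3/4 - \<theta>, 0)}" (is "_ = ?S")
proof (rule social_optima_eqI[where M = "\<theta>/2 + \<theta>\<^sup>2 - 1/48"])
  show "?S \<subseteq> configurations" "?S \<noteq> {}"
    using assms by (auto simp: configurations_def)
next
  fix c assume "c \<in> ?S"
  then consider "c = (1/4 + \<theta>, 3/4 + \<theta>, 1)" | "c = (1/4 - \<theta>, 3/4 - \<theta>, 0)"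
    by blast
  then show "\<exists>t\<in>{0..1}. split_welfare \<theta> c t = \<theta>/2 + \<theta>\<^sup>2 - 1/48"
  proof cases
    case 1
    with assms show ?thesis
      \<comment> \<open>For \<open>q = 1\<close> and facilities at the midpoints, the value is a
        concave quadratic in \<open>t\<close> with this vertex; it is below 1 because
        \<open>\<theta> < 1/4\<close>.\<close>
      by (intro bexI[of _ "1/2 + 2 * \<theta>"])
         (auto simp: split_welfare_def field_simps power2_eq_square)
  next
    case 2
    with assms show ?thesis
      by (intro bexI[of _ "1/2 - 2 * \<theta>"])
         (auto simp: split_welfare_def field_simps power2_eq_square)
  qed
next
  fix c :: "real \<times> real \<times> real" and t :: real
  assume c: "c \<in> configurations" and t: "t \<in> {0..1}"
  obtain a b q where [simp]: "c = (a, b, q)"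
    by (cases c)
  have q: "0 \<le> q" "q \<le> 1"
    using c by (auto simp: configurations_def)
  define A where "A = t * (a - t/2)\<^sup>2"
  define B where "B = (1 - t) * (b - (1 + t)/2)\<^sup>2"
  have nonneg: "0 \<le> A" "0 \<le> B"
    using t by (auto simp: A_def B_def)
  show "split_welfare \<theta> c t \<le> \<theta>/2 + \<theta>\<^sup>2 - 1/48 \<and>
      (split_welfare \<theta> c t = \<theta>/2 + \<theta>\<^sup>2 - 1/48 \<longrightarrow> c \<in> ?S)"
  proof (cases "1/2 \<le> t")
    case True
    \<comment> \<open>\<open>C\<close> is the quality loss compared with \<open>q = 1\<close>:
      moving quality to \<open>a\<close> helps when at least half of the individuals use it.\<close>
    define C where "C = \<theta> * ((1 - q) * (2 * t - 1))"
    have "0 \<le> C"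
      using True q assms by (simp add: C_def)
    have eq: "split_welfare \<theta> c t =
        \<theta>/2 + \<theta>\<^sup>2 - 1/48 - (t - (1/2 + 2 * \<theta>))\<^sup>2 / 4 - C - A - B"
      by (simp add: split_welfare_def A_def B_def C_def field_simps power2_eq_square)
    have "c \<in> ?S" if "split_welfare \<theta> c t = \<theta>/2 + \<theta>\<^sup>2 - 1/48"
    proof -
      \<comment> \<open>At the vertex \<open>1/2 < t < 1\<close>, so all weights are positive:
        \<open>C = 0\<close> forces \<open>q = 1\<close>, and \<open>A = B = 0\<close> put the
        facilities at the midpoints.\<close>
      have "(t - (1/2 + 2 * \<theta>))\<^sup>2 = 0" "C = 0" "A = 0" "B = 0"
        using that nonneg \<open>0 \<le> C\<close> zero_le_power2[of "t - (1/2 + 2 * \<theta>)"] unfolding eq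
        by linarith+
      then show ?thesis
        using assms by (auto simp: A_def B_def C_def)
    qed
    moreover have "split_welfare \<theta> c t \<le> \<theta>/2 + \<theta>\<^sup>2 - 1/48"
      using eq nonneg \<open>0 \<le> C\<close> zero_le_power2[of "t - (1/2 + 2 * \<theta>)"] by linarith
    ultimately show ?thesis
      by blast
  next
    case False
    \<comment> \<open>Mirror image of the first case under \<open>i \<mapsto> 1 - i\<close>, which
      exchanges the facilities; \<open>C\<close> is now the loss compared with
      \<open>q = 0\<close>.\<close>
    define C where "C = \<theta> * (q * (1 - 2 * t))"
    have "0 \<le> C"
      using False q assms by (simp add: C_def)
    have eq: "split_welfare \<theta> c t =
        \<theta>/2 + \<theta>\<^sup>2 - 1/48 - (t - (1/2 - 2 * \<theta>))\<^sup>2 / 4 - C - A - B"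
      by (simp add: split_welfare_def A_def B_def C_def field_simps power2_eq_square)
    have "c \<in> ?S" if "split_welfare \<theta> c t = \<theta>/2 + \<theta>\<^sup>2 - 1/48"
    proof -
      have "(t - (1/2 - 2 * \<theta>))\<^sup>2 = 0" "C = 0" "A = 0" "B = 0"
        using that nonneg \<open>0 \<le> C\<close> zero_le_power2[of "t - (1/2 - 2 * \<theta>)"] unfolding eq
        by linarith+
      then show ?thesis
        using assms by (auto simp: A_def B_def C_def)
    qed
    moreover have "split_welfare \<theta> c t \<le> \<theta>/2 + \<theta>\<^sup>2 - 1/48"
      using eq nonneg \<open>0 \<le> C\<close> zero_le_power2[of "t - (1/2 - 2 * \<theta>)"] by linarith
    ultimately show ?thesis
      by blast
  qed
qed

lemma social_optima_large:
  fixes \<theta> :: real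
  assumes "1/4 \<le> \<theta>"
  shows "social_optima \<theta> = {(1/2, b, 1) |b. b \<in> {1/2..1}} \<union> {(a, 1/2, 0) |a. a \<in> {0..1/2}}"
    (is "_ = ?S")
proof (rule social_optima_eqI[where M = "\<theta> - 1/12"])
  show "?S \<subseteq> configurations" "?S \<noteq> {}"
    by (auto simp: configurations_def intro: exI[of _ "1/2"])
next
  fix c assume "c \<in> ?S"
  then consider b where "c = (1/2, b, 1)" | a where "c = (a, 1/2, 0)"
    by blast
  then show "\<exists>t\<in>{0..1}. split_welfare \<theta> c t = \<theta> - 1/12"
  proof cases
    case 1
    then show ?thesis
      by (intro bexI[of _ 1]) (auto simp: split_welfare_def)
  next
    case 2
    then show ?thesis
      by (intro bexI[of _ 0]) (auto simp: split_welfare_def)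
  qed
next
  fix c :: "real \<times> real \<times> real" and t :: real
  assume c: "c \<in> configurations" and t: "t \<in> {0..1}"
  obtain a b q where [simp]: "c = (a, b, q)"
    by (cases c)
  have abq: "0 \<le> a" "a \<le> b" "b \<le> 1" "0 \<le> q" "q \<le> 1"
    using c by (auto simp: configurations_def)
  define A where "A = t * (a - t/2)\<^sup>2"
  define B where "B = (1 - t) * (b - (1 + t)/2)\<^sup>2"
  have nonneg: "0 \<le> A" "0 \<le> B"
    using t by (auto simp: A_def B_def)
  show "split_welfare \<theta> c t \<le> \<theta> - 1/12 \<and> (split_welfare \<theta> c t = \<theta> - 1/12 \<longrightarrow> c \<in> ?S)"
  proof (cases "1/2 \<le> t")
    case True
    define C where "C = \<theta> * ((1 - q) * (2 * t - 1))"
    \<comment> \<open>\<open>D\<close> is the shortfall from the value at \<open>t = 1\<close>, for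
      \<open>q = 1\<close> and facilities at the midpoints. Its second factor is nonnegative as
      \<open>t / 4 \<le> 1/4 \<le> \<theta>\<close>, and vanishes only if \<open>t = 1\<close>, even
      for \<open>\<theta> = 1/4\<close>.\<close>
    define D where "D = (1 - t) * (\<theta> - t / 4)"
    have "0 \<le> C" "0 \<le> D"
      using True t abq assms by (auto simp: C_def D_def)
    have eq: "split_welfare \<theta> c t = \<theta> - 1/12 - D - C - A - B"
      by (simp add: split_welfare_def A_def B_def C_def D_def field_simps power2_eq_square)
    have "c \<in> ?S" if "split_welfare \<theta> c t = \<theta> - 1/12"
    proof -
      \<comment> \<open>\<open>B\<close> carries the factor \<open>1 - t\<close>, which is 0 here,
        and thus says nothing about \<open>b\<close>; only \<open>a \<le> b \<le> 1\<close> with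
        \<open>a = 1/2\<close> restricts it.\<close>
      have zero: "D = 0" "C = 0" "A = 0"
        using that nonneg \<open>0 \<le> C\<close> \<open>0 \<le> D\<close> unfolding eq by linarith+
      then have "t = 1"
        using t assms by (auto simp: D_def)
      then show ?thesis
        using zero assms abq by (auto simp: A_def C_def)
    qed
    with eq nonneg \<open>0 \<le> C\<close> \<open>0 \<le> D\<close> show ?thesis
      by simp
  next
    case False
    define C where "C = \<theta> * (q * (1 - 2 * t))"
    \<comment> \<open>Mirror image: the shortfall from \<open>t = 0\<close>, where everyone uses
      \<open>b\<close> and \<open>a\<close> is free in \<open>{0..1/2}\<close>.\<close>
    define D where "D = t * (\<theta> - (1 - t) / 4)"
    have "0 \<le> C" "0 \<le> D"
      using False t abq assms by (auto simp: C_def D_def)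
    have eq: "split_welfare \<theta> c t = \<theta> - 1/12 - D - C - A - B"
      by (simp add: split_welfare_def A_def B_def C_def D_def field_simps power2_eq_square)
    have "c \<in> ?S" if "split_welfare \<theta> c t = \<theta> - 1/12"
    proof -
      have zero: "D = 0" "C = 0" "B = 0"
        using that nonneg \<open>0 \<le> C\<close> \<open>0 \<le> D\<close> unfolding eq by linarith+
      then have "t = 0"
        using t assms by (auto simp: D_def)
      then show ?thesis
        using zero assms abq by (auto simp: B_def C_def)
    qed
    with eq nonneg \<open>0 \<le> C\<close> \<open>0 \<le> D\<close> show ?thesis
      by simp
  qed
qed

theorem theorem1:
  fixes \<theta> :: real
  assumes "\<theta> > 0"
  shows "(\<theta> \<in> {0<..<1/4} \<longrightarrow>
            social_optima \<theta> = {(1/4 + \<theta>, 3/4 + \<theta>, 1), (1/4 - \<theta>, 3/4 - \<theta>, 0)}) \<and>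
         (\<theta> \<in> {1/4..} \<longrightarrow>
            social_optima \<theta> = {(1/2, b, 1) |b. b \<in> {1/2..1}} \<union> {(a, 1/2, 0) |a. a \<in> {0..1/2}})"
  using social_optima_small[of \<theta>] social_optima_large[of \<theta>] by simp

end
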